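(* Let $n\ge 1$. For every $n$-tuple $\varrho=(\rho_1,\dots,\rho_n)$ of single-qubit density matrices $\rho_i\in\mathcal{D}(\mathbb{C}^2)$, the value of the Bargmann invariant $\operatorname{Tr}(\rho_1\cdots\rho_n)$ is completely determined, up to complex conjugation, by the overlaps $(\operatorname{Tr}(\rho_i\rho_j))_{i,j=1}^n$ (that is, if two such tuples $\varrho,\varsigma$ have $\operatorname{Tr}(\rho_i\rho_j)=\operatorname{Tr}(\sigma_i\sigma_j)$ for all $1\le i,j\le n$, then $\operatorname{Tr}(\sigma_1\cdots\sigma_n)$ equals $\operatorname{Tr}(\rho_1\cdots\rho_n)$ or its complex conjugate). More precisely, there exist polynomials $P_n,Q_n\in\mathbb{Q}[\Delta_{11},\Delta_{12},\dots,\Delta_{nn}]$ (depending only on $n$) such that for every such $\varrho$ $$[\operatorname{Tr}(\rho_1\cdots\rho_n)]^2-2P_n(\mathsf{\Delta}(\varrho))\operatorname{Tr}(\rho_1\cdots\rho_n)+Q_n(\mathsf{\Delta}(\varrho))=0,$$ where $P_n(\mathsf{\Delta}(\varrho))$ and $Q_n(\mathsf{\Delta}(\varrho))$ are obtained by substituting $\operatorname{Tr}(\rho_i\rho_j)$ for each variable $\Delta_{ij}$.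
   Context: $\mathcal{D}(\mathbb{C}^2)$ is the set of $2\times 2$ density matrices (positive semidefinite, trace one). $\mathbb{Q}[\Delta_{11},\Delta_{12},\dots,\Delta_{nn}]$ is the polynomial ring with rational coefficients in variables $\Delta_{ij}$, $1\le i,j\le n$. *)

theory Defs
  imports "HOL-Analysis.Analysis" "HOL-Library.Poly_Mapping"
begin

definition hermitian :: "complex ^ 'd ^ 'd \<Rightarrow> bool" where
  "hermitian A \<longleftrightarrow> (\<forall>i j. A $ i $ j = cnj (A $ j $ i))"

definition pos_semidef :: "complex ^ 'd ^ 'd \<Rightarrow> bool" where
  "pos_semidef A \<longleftrightarrow> hermitian A \<and>
     (\<forall>v :: complex ^ 'd. (\<Sum>i\<in>UNIV. cnj (v $ i) * (A *v v) $ i) \<in> \<real>\<^sub>\<ge>\<^sub>0)"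

definition density_matrices :: "(complex ^ 'd ^ 'd) set" where
  "density_matrices = {A. pos_semidef A \<and> trace A = 1}"

text \<open>An \<open>n\<close>-tuple of matrices is a function on \<open>nat\<close> whose values at \<open>1, \<dots>, n\<close>
  are the entries of the tuple; all other values are irrelevant.\<close>

definition bargmann :: "nat \<Rightarrow> (nat \<Rightarrow> complex ^ 'd ^ 'd) \<Rightarrow> complex" where
  "bargmann n \<rho> = trace (foldr (\<lambda>i M. \<rho> i ** M) [1..<Suc n] (mat 1))"

definition overlap :: "(nat \<Rightarrow> complex ^ 'd ^ 'd) \<Rightarrow> nat \<times> nat \<Rightarrow> complex" where
  "overlap \<rho> = (\<lambda>(i, j). trace (\<rho> i ** \<rho> j))"

text \<open>Polynomials over \<open>\<rat>\<close> in commuting variables \<open>\<Delta>\<^sub>i\<^sub>j\<close> indexed by pairs \<open>(i, j)\<close>: finitely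
  supported maps from monomials (finitely supported exponent functions) to coefficients.
  \<open>overlap_polys n\<close> is the subring in the \<open>n\<^sup>2\<close> variables with \<open>1 \<le> i, j \<le> n\<close>.\<close>

type_synonym overlap_poly = "(nat \<times> nat \<Rightarrow>\<^sub>0 nat) \<Rightarrow>\<^sub>0 rat"

definition overlap_polys :: "nat \<Rightarrow> overlap_poly set" where
  "overlap_polys n =
     {p. \<forall>m \<in> Poly_Mapping.keys p. Poly_Mapping.keys m \<subseteq> {1..n} \<times> {1..n}}"

definition eval_poly :: "overlap_poly \<Rightarrow> (nat \<times> nat \<Rightarrow> complex) \<Rightarrow> complex" where
  "eval_poly p x =
     (\<Sum>m \<in> Poly_Mapping.keys p. of_rat (Poly_Mapping.lookup p m) *
        (\<Prod>v \<in> Poly_Mapping.keys m. x v ^ Poly_Mapping.lookup m v))"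

end

theory Submission
  imports Defs
begin

text \<open>In Bloch form a density matrix is \<open>(1 + r \<bullet> \<sigma>) / 2\<close>, and a product of such matrices is
  \<open>(s + i t) + (u + i w) \<bullet> \<sigma>\<close> with \<open>s, t\<close> real and \<open>u, w\<close> real vectors. Multiplying by one more
  factor shows inductively that, with coefficients that are rational polynomials in the \<open>r\<^sub>i \<bullet> r\<^sub>j\<close>
  (equivalently, in the overlaps), \<open>s\<close> is a scalar, \<open>u\<close> a combination of the \<open>r\<^sub>j\<close>, \<open>w\<close> a combination
  of the \<open>r\<^sub>j \<times> r\<^sub>k\<close>, and \<open>t\<close> a combination of the triple products \<open>r\<^sub>i \<bullet> (r\<^sub>j \<times> r\<^sub>k)\<close>. The trace is
  \<open>2 (s + i t)\<close>; its real part is thus a polynomial, and so is its squared modulus \<open>4 (s\<^sup>2 + t\<^sup>2)\<close>,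
  because a product of two triple products is a Gram determinant.\<close>

subsection \<open>Evaluation of polynomials\<close>

definition eval_monomial :: "(nat \<times> nat \<Rightarrow> complex) \<Rightarrow> (nat \<times> nat \<Rightarrow>\<^sub>0 nat) \<Rightarrow> complex" where
  "eval_monomial x m = (\<Prod>v \<in> Poly_Mapping.keys m. x v ^ Poly_Mapping.lookup m v)"

text \<open>Variables outside the support have exponent 0 and contribute the factor 1. Enlarging the
  index set lets monomials with different supports be compared over one common set.\<close>

lemma eval_monomial_superset:
  assumes "finite A" "Poly_Mapping.keys m \<subseteq> A"
  shows "eval_monomial x m = (\<Prod>v\<in>A. x v ^ Poly_Mapping.lookup m v)"
  unfolding eval_monomial_def using assms
  by (intro prod.mono_neutral_left) (auto simp: in_keys_iff)

lemma eval_monomial_zero [simp]: "eval_monomial x 0 = 1"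
  by (simp add: eval_monomial_def)

lemma eval_monomial_single: "eval_monomial x (Poly_Mapping.single v (Suc 0)) = x v"
  by (simp add: eval_monomial_def)

lemma eval_monomial_add: "eval_monomial x (m + m') = eval_monomial x m * eval_monomial x m'"
proof -
  let ?A = "Poly_Mapping.keys m \<union> Poly_Mapping.keys m'"
  have "eval_monomial x (m + m') = (\<Prod>v\<in>?A. x v ^ Poly_Mapping.lookup (m + m') v)"
    using keys_add[of m m'] by (intro eval_monomial_superset) auto
  also have "\<dots> = (\<Prod>v\<in>?A. x v ^ Poly_Mapping.lookup m v) * (\<Prod>v\<in>?A. x v ^ Poly_Mapping.lookup m' v)"
    by (simp add: lookup_add power_add prod.distrib)
  also have "\<dots> = eval_monomial x m * eval_monomial x m'"
    by (simp add: eval_monomial_superset[of ?A])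
  finally show ?thesis .
qed

lemma eval_poly_superset:
  assumes "finite A" "Poly_Mapping.keys p \<subseteq> A"
  shows "eval_poly p x = (\<Sum>m\<in>A. of_rat (Poly_Mapping.lookup p m) * eval_monomial x m)"
  unfolding eval_poly_def eval_monomial_def using assms
  by (intro sum.mono_neutral_left) (auto simp: in_keys_iff)

lemma eval_poly_zero [simp]: "eval_poly 0 x = 0"
  by (simp add: eval_poly_def)

lemma eval_poly_single: "eval_poly (Poly_Mapping.single m c) x = of_rat c * eval_monomial x m"
  by (subst eval_poly_superset[of "{m}"]) auto

lemma eval_poly_add: "eval_poly (p + q) x = eval_poly p x + eval_poly q x"
proof -
  let ?A = "Poly_Mapping.keys p \<union> Poly_Mapping.keys q"
  have "Poly_Mapping.keys (p + q) \<subseteq> ?A"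
    by (rule keys_add)
  then show ?thesis
    by (simp add: eval_poly_superset[of ?A] lookup_add of_rat_add distrib_right sum.distrib)
qed

lemma eval_poly_sum: "eval_poly (sum f A) x = (\<Sum>a\<in>A. eval_poly (f a) x)"
  by (induction A rule: infinite_finite_induct) (auto simp: eval_poly_add)

text \<open>Reduces multiplicativity of evaluation to single terms, where exponents add.\<close>

lemma poly_mapping_eq_sum_single:
  "p = (\<Sum>m\<in>Poly_Mapping.keys p. Poly_Mapping.single m (Poly_Mapping.lookup p m))"
proof (rule poly_mapping_eqI)
  fix k
  have "(\<Sum>m\<in>Poly_Mapping.keys p. (Poly_Mapping.lookup p m when m = k)) = Poly_Mapping.lookup p k"
    by (simp add: when_def in_keys_iff)
  then show "Poly_Mapping.lookup p k = Poly_Mapping.lookup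
      (\<Sum>m\<in>Poly_Mapping.keys p. Poly_Mapping.single m (Poly_Mapping.lookup p m)) k"
    by (simp add: lookup_sum lookup_single)
qed

lemma eval_poly_mult: "eval_poly (p * q) x = eval_poly p x * eval_poly q x"
proof -
  let ?s = "\<lambda>p m. Poly_Mapping.single m (Poly_Mapping.lookup p m)"
  have "p * q = (\<Sum>m\<in>Poly_Mapping.keys p. ?s p m) * (\<Sum>m\<in>Poly_Mapping.keys q. ?s q m)"
    by (simp flip: poly_mapping_eq_sum_single)
  also have "eval_poly \<dots> x = (\<Sum>m\<in>Poly_Mapping.keys p. \<Sum>m'\<in>Poly_Mapping.keys q.
      (of_rat (Poly_Mapping.lookup p m) * eval_monomial x m) *
      (of_rat (Poly_Mapping.lookup q m') * eval_monomial x m'))"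
    by (simp add: sum_product mult_single eval_poly_sum eval_poly_single eval_monomial_add
        of_rat_mult mult_ac)
  also have "\<dots> = eval_poly p x * eval_poly q x"
    unfolding eval_poly_superset[OF finite_keys order_refl] by (simp add: sum_product)
  finally show ?thesis .
qed

section \<open>The subring in the variables indexed by \<open>{1..n} \<times> {1..n}\<close>\<close>

lemma eval_poly_cong:
  assumes "p \<in> overlap_polys n" "\<And>i j. i \<in> {1..n} \<Longrightarrow> j \<in> {1..n} \<Longrightarrow> x (i, j) = y (i, j)"
  shows "eval_poly p x = eval_poly p y"
  using assms unfolding eval_poly_def overlap_polys_def
  by (intro sum.cong prod.cong arg_cong2[where f = "(*)"] refl) fastforce

lemma overlap_polys_add: "p \<in> overlap_polys n \<Longrightarrow> q \<in> overlap_polys n \<Longrightarrow> p + q \<in> overlap_polys n"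
  using keys_add[of p q] unfolding overlap_polys_def by blast

text \<open>Each monomial of a product is a sum of exponent functions, one from each factor, so its
  variables already occur in one of them.\<close>

lemma overlap_polys_mult:
  assumes "p \<in> overlap_polys n" "q \<in> overlap_polys n"
  shows "p * q \<in> overlap_polys n"
  unfolding overlap_polys_def
proof safe
  fix m a b assume "m \<in> Poly_Mapping.keys (p * q)" "(a, b) \<in> Poly_Mapping.keys m"
  then obtain m1 m2 where "m = m1 + m2" "m1 \<in> Poly_Mapping.keys p" "m2 \<in> Poly_Mapping.keys q"
    using keys_mult[of p q] by blast
  moreover from this have "(a, b) \<in> Poly_Mapping.keys m1 \<union> Poly_Mapping.keys m2"
    using keys_add[of m1 m2] \<open>(a, b) \<in> _\<close> by blast
  ultimately show "a \<in> {1..n}" "b \<in> {1..n}"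
    using assms unfolding overlap_polys_def by blast+
qed

subsection \<open>Functions spanned over the polynomials in the overlaps\<close>

type_synonym qubit_tuple = "nat \<Rightarrow> complex ^ 2 ^ 2"

text \<open>Agreement with a polynomial is demanded only on tuples of density matrices, because
  Bloch vectors are linked to overlaps only there.\<close>

definition overlap_functions :: "nat \<Rightarrow> (qubit_tuple \<Rightarrow> real) set" where
  "overlap_functions n = {f. \<exists>p\<in>overlap_polys n. \<forall>\<rho>.
     (\<forall>i\<in>{1..n}. \<rho> i \<in> density_matrices) \<longrightarrow> eval_poly p (overlap \<rho>) = of_real (f \<rho>)}"

lemma overlap_functionsI:
  assumes "p \<in> overlap_polys n"
    "\<And>\<rho>. (\<And>i. i \<in> {1..n} \<Longrightarrow> \<rho> i \<in> density_matrices) \<Longrightarrow> eval_poly p (overlap \<rho>) = of_real (f \<rho>)"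
  shows "f \<in> overlap_functions n"
  using assms unfolding overlap_functions_def by blast

lemma overlap_functionsE:
  assumes "f \<in> overlap_functions n"
  obtains p where "p \<in> overlap_polys n"
    "\<And>\<rho>. (\<And>i. i \<in> {1..n} \<Longrightarrow> \<rho> i \<in> density_matrices) \<Longrightarrow> eval_poly p (overlap \<rho>) = of_real (f \<rho>)"
  using assms unfolding overlap_functions_def by blast

lemma overlap_functions_add:
  assumes "f \<in> overlap_functions n" "g \<in> overlap_functions n"
  shows "(\<lambda>\<rho>. f \<rho> + g \<rho>) \<in> overlap_functions n"
proof -
  obtain p q where "p \<in> overlap_polys n" "q \<in> overlap_polys n"
    "\<And>\<rho>. (\<And>i. i \<in> {1..n} \<Longrightarrow> \<rho> i \<in> density_matrices) \<Longrightarrow> eval_poly p (overlap \<rho>) = of_real (f \<rho>)"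
    "\<And>\<rho>. (\<And>i. i \<in> {1..n} \<Longrightarrow> \<rho> i \<in> density_matrices) \<Longrightarrow> eval_poly q (overlap \<rho>) = of_real (g \<rho>)"
    using assms by (metis overlap_functionsE)
  then show ?thesis
    by (intro overlap_functionsI[of "p + q"]) (simp_all add: overlap_polys_add eval_poly_add)
qed

lemma overlap_functions_mult:
  assumes "f \<in> overlap_functions n" "g \<in> overlap_functions n"
  shows "(\<lambda>\<rho>. f \<rho> * g \<rho>) \<in> overlap_functions n"
proof -
  obtain p q where "p \<in> overlap_polys n" "q \<in> overlap_polys n"
    "\<And>\<rho>. (\<And>i. i \<in> {1..n} \<Longrightarrow> \<rho> i \<in> density_matrices) \<Longrightarrow> eval_poly p (overlap \<rho>) = of_real (f \<rho>)"
    "\<And>\<rho>. (\<And>i. i \<in> {1..n} \<Longrightarrow> \<rho> i \<in> density_matrices) \<Longrightarrow> eval_poly q (overlap \<rho>) = of_real (g \<rho>)"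
    using assms by (metis overlap_functionsE)
  then show ?thesis
    by (intro overlap_functionsI[of "p * q"]) (simp_all add: overlap_polys_mult eval_poly_mult)
qed

lemma overlap_functions_of_rat: "(\<lambda>\<rho>. of_rat c) \<in> overlap_functions n"
proof (rule overlap_functionsI)
  show "Poly_Mapping.single 0 c \<in> overlap_polys n"
    by (auto simp: overlap_polys_def)
  show "eval_poly (Poly_Mapping.single 0 c) (overlap \<rho>) = of_real (of_rat c)" for \<rho> :: qubit_tuple
    \<comment> \<open>Writing \<open>c\<close> as a fraction shows that the embedding of the
      rationals into the complex numbers agrees with the one through the reals.\<close>
    by (cases c) (simp add: eval_poly_single of_rat_rat)
qed

lemma overlap_functions_numeral [simp]:
  "(\<lambda>\<rho>. 0) \<in> overlap_functions n" "(\<lambda>\<rho>. 1) \<in> overlap_functions n"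
  "(\<lambda>\<rho>. numeral k) \<in> overlap_functions n" "(\<lambda>\<rho>. - 1) \<in> overlap_functions n"
  "(\<lambda>\<rho>. 1 / 2) \<in> overlap_functions n"
  using overlap_functions_of_rat[of 0 n] overlap_functions_of_rat[of 1 n]
    overlap_functions_of_rat[of "numeral k" n] overlap_functions_of_rat[of "- 1" n]
    overlap_functions_of_rat[of "1 / 2" n]
  by (simp_all add: of_rat_minus of_rat_divide)

text \<open>The module generated by \<open>B\<close> over the ring
  \<open>overlap_functions n\<close>. The inductive form makes a linear statement about it reducible
  to the generators.\<close>

inductive_set overlap_span :: "nat \<Rightarrow> (qubit_tuple \<Rightarrow> 'v::real_vector) set \<Rightarrow> (qubit_tuple \<Rightarrow> 'v) set"
  for n B where
  zero: "(\<lambda>\<rho>. 0) \<in> overlap_span n B"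
| add_scaleR: "f \<in> overlap_functions n \<Longrightarrow> b \<in> B \<Longrightarrow> g \<in> overlap_span n B \<Longrightarrow>
    (\<lambda>\<rho>. f \<rho> *\<^sub>R b \<rho> + g \<rho>) \<in> overlap_span n B"

lemma overlap_span_base: "b \<in> B \<Longrightarrow> b \<in> overlap_span n B"
  using add_scaleR[of "\<lambda>_. 1" n b B "\<lambda>_. 0"] by (simp add: zero)

lemma overlap_span_add:
  assumes "f \<in> overlap_span n B" "g \<in> overlap_span n B"
  shows "(\<lambda>\<rho>. f \<rho> + g \<rho>) \<in> overlap_span n B"
  using assms(1) by induction (auto simp: assms add.assoc intro: add_scaleR)

lemma overlap_span_scaleR:
  assumes "g \<in> overlap_span n B" "f \<in> overlap_functions n"
  shows "(\<lambda>\<rho>. f \<rho> *\<^sub>R g \<rho>) \<in> overlap_span n B"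
  using assms(1)
  by induction (auto simp: scaleR_add_right zero intro!: add_scaleR overlap_functions_mult assms)

lemma overlap_span_diff:
  assumes "f \<in> overlap_span n B" "g \<in> overlap_span n B"
  shows "(\<lambda>\<rho>. f \<rho> - g \<rho>) \<in> overlap_span n B"
  using overlap_span_add[OF assms(1) overlap_span_scaleR[OF assms(2), of "\<lambda>_. - 1"]] by simp

text \<open>The coefficients are real at each tuple, so a pointwise linear map passes through them.
  Since \<open>h\<close> may depend on \<open>\<rho>\<close>, multiplication by a Bloch vector or by
  another function of the tuple is covered.\<close>

lemma overlap_span_linear_image:
  assumes "f \<in> overlap_span n B" "\<And>\<rho>. linear (h \<rho>)"
    "\<And>b. b \<in> B \<Longrightarrow> (\<lambda>\<rho>. h \<rho> (b \<rho>)) \<in> overlap_span n C"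
  shows "(\<lambda>\<rho>. h \<rho> (f \<rho>)) \<in> overlap_span n C"
  using assms(1)
  by induction
    (auto simp: assms linear_0 linear_add linear_scale zero intro!: overlap_span_add overlap_span_scaleR)

text \<open>The coefficient ring regarded as a module over itself, so that
  \<open>overlap_span_linear_image\<close> can have it as its target.\<close>

abbreviation scalars :: "nat \<Rightarrow> (qubit_tuple \<Rightarrow> real) set" where
  "scalars n \<equiv> overlap_span n {\<lambda>_. 1}"

lemma scalars_eq: "scalars n = overlap_functions n"
proof (intro equalityI subsetI)
  fix f assume "f \<in> scalars n"
  then show "f \<in> overlap_functions n"
    by induction (auto intro: overlap_functions_add)
next
  fix f assume "f \<in> overlap_functions n"
  then show "f \<in> scalars n"
    using overlap_span_scaleR[OF overlap_span_base, of "\<lambda>_. 1 :: real" "{\<lambda>_. 1}" f n] by simp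
qed

subsection \<open>Bloch vectors\<close>

text \<open>For Hermitian \<open>A\<close> the coordinates are the traces of \<open>A\<close> times
  the three Pauli matrices.\<close>

definition bloch :: "complex ^ 2 ^ 2 \<Rightarrow> real ^ 3" where
  "bloch A = vector [2 * Re (A $ 1 $ 2), - 2 * Im (A $ 1 $ 2), Re (A $ 1 $ 1) - Re (A $ 2 $ 2)]"

text \<open>The matrix \<open>(s + i t) + (u + i w) \<bullet> \<sigma>\<close>, where \<open>\<sigma>\<close> is the vector of Pauli matrices.\<close>

definition pauli :: "real \<Rightarrow> real \<Rightarrow> real ^ 3 \<Rightarrow> real ^ 3 \<Rightarrow> complex ^ 2 ^ 2" where
  "pauli s t u w = vector
    [vector [Complex (s + u $ 3) (t + w $ 3), Complex (u $ 1 + w $ 2) (w $ 1 - u $ 2)],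
     vector [Complex (u $ 1 - w $ 2) (w $ 1 + u $ 2), Complex (s - u $ 3) (t - w $ 3)]]"

lemma mat_1_eq_pauli: "mat 1 = pauli 1 0 0 0"
  by (simp add: pauli_def vec_eq_iff forall_2 mat_def complex_eq_iff)

lemma trace_pauli: "trace (pauli s t u w) = Complex (2 * s) (2 * t)"
  by (simp add: pauli_def trace_def sum_2 complex_eq_iff)

text \<open>This is (r . \<sigma>)(v . \<sigma>) = r . v + i (r \<times> v) . \<sigma> with v = u +
  i w: the factor i sends the cross product with \<open>w\<close> to the real vector part, with a
  minus sign, and the one with \<open>u\<close> to the imaginary part.\<close>

lemma pauli_mult_hermitian:
  "pauli a 0 r 0 ** pauli s t u w = pauli (a * s + r \<bullet> u) (a * t + r \<bullet> w)
     (a *\<^sub>R u + s *\<^sub>R r - cross3 r w) (a *\<^sub>R w + t *\<^sub>R r + cross3 r u)"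
  unfolding pauli_def vec_eq_iff forall_2
  by (simp add: matrix_matrix_mult_def sum_2 complex_eq_iff inner_vec_def sum_3 cross3_def)
    (simp add: algebra_simps)

lemma pauli_mult:
  "pauli (1/2) 0 ((1/2) *\<^sub>R r) 0 ** pauli s t u w =
   pauli ((1/2) *\<^sub>R (s + r \<bullet> u)) ((1/2) *\<^sub>R (t + r \<bullet> w))
     ((1/2) *\<^sub>R (u + s *\<^sub>R r - cross3 r w)) ((1/2) *\<^sub>R (w + t *\<^sub>R r + cross3 r u))"
  by (simp add: pauli_mult_hermitian cross_mult_left scaleR_add_right scaleR_diff_right
      add_divide_distrib)

text \<open>Hermiticity leaves four real parameters, and trace one fixes the coefficient of the
  identity at 1/2.\<close>

lemma density_matrix_eq_pauli:
  assumes "A \<in> density_matrices"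
  shows "A = pauli (1/2) 0 ((1/2) *\<^sub>R bloch A) 0"
proof -
  have "A $ i $ j = cnj (A $ j $ i)" for i j
    using assms unfolding density_matrices_def pos_semidef_def hermitian_def by blast
  from this[of 1 1] this[of 2 2] this[of 2 1] have
    "Im (A $ 1 $ 1) = 0" "Im (A $ 2 $ 2) = 0" "A $ 2 $ 1 = cnj (A $ 1 $ 2)"
    by (auto simp: complex_eq_iff)
  moreover have "Re (A $ 1 $ 1) + Re (A $ 2 $ 2) = 1"
    using assms by (auto simp: density_matrices_def trace_def sum_2 complex_eq_iff)
  ultimately show ?thesis
    by (auto simp: pauli_def bloch_def vec_eq_iff forall_2 complex_eq_iff field_simps)
qed

lemma trace_mult_density_matrices:
  assumes "A \<in> density_matrices" "B \<in> density_matrices"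
  shows "trace (A ** B) = of_real ((1 + bloch A \<bullet> bloch B) / 2)"
  by (subst density_matrix_eq_pauli[OF assms(1)], subst density_matrix_eq_pauli[OF assms(2)])
    (simp add: pauli_mult trace_pauli complex_eq_iff field_simps)

text \<open>The overlap is (1 + r . r') / 2, which is inverted by doubling and subtracting 1. The
  case \<open>i = j\<close> is included: squared lengths come from the diagonal variables.\<close>

lemma inner_bloch_overlap_functions:
  assumes "i \<in> {1..n}" "j \<in> {1..n}"
  shows "(\<lambda>\<rho>. bloch (\<rho> i) \<bullet> bloch (\<rho> j)) \<in> overlap_functions n"
proof -
  have "(\<lambda>\<rho>. (1 + bloch (\<rho> i) \<bullet> bloch (\<rho> j)) / 2) \<in> overlap_functions n"
  proof (rule overlap_functionsI)
    let ?p = "Poly_Mapping.single (Poly_Mapping.single (i, j) 1) 1 :: overlap_poly"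
    show "?p \<in> overlap_polys n"
      using assms by (auto simp: overlap_polys_def)
    show "eval_poly ?p (overlap \<rho>) = of_real ((1 + bloch (\<rho> i) \<bullet> bloch (\<rho> j)) / 2)"
      if "\<And>i. i \<in> {1..n} \<Longrightarrow> \<rho> i \<in> density_matrices" for \<rho> :: qubit_tuple
      using trace_mult_density_matrices[OF that[OF assms(1)] that[OF assms(2)]]
      by (simp add: eval_poly_single eval_monomial_single overlap_def)
  qed
  from overlap_functions_add[OF overlap_functions_mult[OF _ this, of "\<lambda>_. 2"], of "\<lambda>_. - 1"]
  show ?thesis by (simp add: add_divide_distrib)
qed

subsection \<open>Products of density matrices\<close>

text \<open>The names of the classes follow the behaviour of their generators when one orthogonal
  map acts on all Bloch vectors: the pseudo classes pick up its determinant.\<close>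

abbreviation vectors :: "nat \<Rightarrow> (qubit_tuple \<Rightarrow> real ^ 3) set" where
  "vectors n \<equiv> overlap_span n {\<lambda>\<rho>. bloch (\<rho> j) |j. j \<in> {1..n}}"

abbreviation pseudovectors :: "nat \<Rightarrow> (qubit_tuple \<Rightarrow> real ^ 3) set" where
  "pseudovectors n \<equiv> overlap_span n
    {\<lambda>\<rho>. cross3 (bloch (\<rho> j)) (bloch (\<rho> k)) |j k. j \<in> {1..n} \<and> k \<in> {1..n}}"

abbreviation pseudoscalars :: "nat \<Rightarrow> (qubit_tuple \<Rightarrow> real) set" where
  "pseudoscalars n \<equiv> overlap_span n
    {\<lambda>\<rho>. bloch (\<rho> i) \<bullet> cross3 (bloch (\<rho> j)) (bloch (\<rho> k)) |i j k.
       i \<in> {1..n} \<and> j \<in> {1..n} \<and> k \<in> {1..n}}"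

section \<open>Products of a Bloch vector with the four classes\<close>

lemma linear_cross3: "linear (cross3 a)"
  using bilinear_cross by (auto simp: bilinear_def)

lemma linear_inner: "linear ((\<bullet>) (a :: real ^ 3))"
  by (intro linearI) (simp_all add: inner_add_right)

lemma bloch_vectors: "j \<in> {1..n} \<Longrightarrow> (\<lambda>\<rho>. bloch (\<rho> j)) \<in> vectors n"
  by (rule overlap_span_base) blast

lemma cross3_bloch_bloch:
  "j \<in> {1..n} \<Longrightarrow> k \<in> {1..n} \<Longrightarrow> (\<lambda>\<rho>. cross3 (bloch (\<rho> j)) (bloch (\<rho> k))) \<in> pseudovectors n"
  by (rule overlap_span_base) blast

lemma inner_bloch_vectors:
  assumes "i \<in> {1..n}" "u \<in> vectors n"
  shows "(\<lambda>\<rho>. bloch (\<rho> i) \<bullet> u \<rho>) \<in> scalars n"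
  using assms(2) by (rule overlap_span_linear_image)
    (auto simp: scalars_eq linear_inner intro: inner_bloch_overlap_functions[OF assms(1)])

lemma cross3_bloch_vectors:
  assumes "i \<in> {1..n}" "u \<in> vectors n"
  shows "(\<lambda>\<rho>. cross3 (bloch (\<rho> i)) (u \<rho>)) \<in> pseudovectors n"
  using assms(2)
proof (rule overlap_span_linear_image)
  fix b assume "b \<in> {\<lambda>\<rho>. bloch (\<rho> j) |j. j \<in> {1..n}}"
  then show "(\<lambda>\<rho>. cross3 (bloch (\<rho> i)) (b \<rho>)) \<in> pseudovectors n"
    using assms(1) by (intro overlap_span_base) blast
qed (rule linear_cross3)

lemma inner_bloch_pseudovectors:
  assumes "i \<in> {1..n}" "w \<in> pseudovectors n"
  shows "(\<lambda>\<rho>. bloch (\<rho> i) \<bullet> w \<rho>) \<in> pseudoscalars n"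
  using assms(2)
proof (rule overlap_span_linear_image)
  fix b assume "b \<in> {\<lambda>\<rho>. cross3 (bloch (\<rho> j)) (bloch (\<rho> k)) |j k. j \<in> {1..n} \<and> k \<in> {1..n}}"
  then show "(\<lambda>\<rho>. bloch (\<rho> i) \<bullet> b \<rho>) \<in> pseudoscalars n"
    using assms(1) by (intro overlap_span_base) blast
qed (rule linear_inner)

text \<open>The Lagrange expansion of a \<times> (b \<times> c) is a combination of \<open>b\<close>
  and \<open>c\<close> with inner products as coefficients.\<close>

lemma cross3_bloch_pseudovectors:
  assumes "i \<in> {1..n}" "w \<in> pseudovectors n"
  shows "(\<lambda>\<rho>. cross3 (bloch (\<rho> i)) (w \<rho>)) \<in> vectors n"
  using assms(2)
proof (rule overlap_span_linear_image)
  fix b assume "b \<in> {\<lambda>\<rho>. cross3 (bloch (\<rho> j)) (bloch (\<rho> k)) |j k. j \<in> {1..n} \<and> k \<in> {1..n}}"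
  then obtain j k where jk: "b = (\<lambda>\<rho>. cross3 (bloch (\<rho> j)) (bloch (\<rho> k)))" "j \<in> {1..n}" "k \<in> {1..n}"
    by blast
  show "(\<lambda>\<rho>. cross3 (bloch (\<rho> i)) (b \<rho>)) \<in> vectors n"
    unfolding jk(1) Lagrange using assms(1) jk
    by (intro overlap_span_diff overlap_span_scaleR bloch_vectors inner_bloch_overlap_functions)
qed (rule linear_cross3)

text \<open>If \<open>a\<close>, \<open>b\<close>, \<open>c\<close> form a basis, this is the
  expansion of \<open>r\<close> in the dual basis, cleared of the denominator a . (b \<times> c). As
  a polynomial identity in the coordinates it holds for all vectors.\<close>

lemma triple_product_scaleR:
  "(a \<bullet> cross3 b c) *\<^sub>R r = (a \<bullet> r) *\<^sub>R cross3 b c + (b \<bullet> r) *\<^sub>R cross3 c a + (c \<bullet> r) *\<^sub>R cross3 a b"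
  by (simp add: cross3_simps forall_3)

lemma scaleR_bloch_pseudoscalars:
  assumes "i \<in> {1..n}" "t \<in> pseudoscalars n"
  shows "(\<lambda>\<rho>. t \<rho> *\<^sub>R bloch (\<rho> i)) \<in> pseudovectors n"
  using assms(2)
proof (rule overlap_span_linear_image)
  fix b assume "b \<in> {\<lambda>\<rho>. bloch (\<rho> i) \<bullet> cross3 (bloch (\<rho> j)) (bloch (\<rho> k)) |i j k.
    i \<in> {1..n} \<and> j \<in> {1..n} \<and> k \<in> {1..n}}"
  then obtain j k l where
    b: "b = (\<lambda>\<rho>. bloch (\<rho> j) \<bullet> cross3 (bloch (\<rho> k)) (bloch (\<rho> l)))"
    "j \<in> {1..n}" "k \<in> {1..n}" "l \<in> {1..n}"
    by blast
  show "(\<lambda>\<rho>. b \<rho> *\<^sub>R bloch (\<rho> i)) \<in> pseudovectors n"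
    unfolding b(1) triple_product_scaleR using assms(1) b
    by (intro overlap_span_add overlap_span_scaleR cross3_bloch_bloch
        inner_bloch_overlap_functions)
qed (simp add: linear_iff scaleR_add_left)

text \<open>The product of two 3 by 3 determinants is the determinant of the matrix of inner
  products, expanded here along the row of \<open>a\<close>. Minus signs are written as
  \<open>(- 1) *\<close> so that closure of \<open>overlap_functions\<close> under sums and products
  applies directly.\<close>

lemma triple_product_mult_eq_Gram:
  "(a \<bullet> cross3 b c) * (d \<bullet> cross3 e f) =
    (a \<bullet> d) * ((b \<bullet> e) * (c \<bullet> f) + (- 1) * ((b \<bullet> f) * (c \<bullet> e)))
    + (a \<bullet> e) * ((b \<bullet> f) * (c \<bullet> d) + (- 1) * ((b \<bullet> d) * (c \<bullet> f)))
    + (a \<bullet> f) * ((b \<bullet> d) * (c \<bullet> e) + (- 1) * ((b \<bullet> e) * (c \<bullet> d)))"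
proof -
  \<comment> \<open>Attaching the second triple product to \<open>a\<close> turns it into a
    combination of cross products, whose inner products with \<open>cross3 b c\<close> are 2 by 2
    determinants.\<close>
  have "(a \<bullet> cross3 b c) * (d \<bullet> cross3 e f) = ((d \<bullet> cross3 e f) *\<^sub>R a) \<bullet> cross3 b c"
    by simp
  also have "\<dots> = (a \<bullet> d) * (cross3 e f \<bullet> cross3 b c) + (a \<bullet> e) * (cross3 f d \<bullet> cross3 b c)
      + (a \<bullet> f) * (cross3 d e \<bullet> cross3 b c)"
    unfolding triple_product_scaleR by (simp add: inner_add_left inner_add_right inner_commute)
  finally show ?thesis
    by (simp add: dot_cross inner_commute algebra_simps)
qed

text \<open>Linearity in each factor in turn reduces the claim to two generators, where the Gram
  determinant applies.\<close>

lemma pseudoscalars_mult: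
  assumes "t \<in> pseudoscalars n" "t' \<in> pseudoscalars n"
  shows "(\<lambda>\<rho>. t \<rho> * t' \<rho>) \<in> scalars n"
  using assms(1)
proof (rule overlap_span_linear_image)
  fix b assume "b \<in> {\<lambda>\<rho>. bloch (\<rho> i) \<bullet> cross3 (bloch (\<rho> j)) (bloch (\<rho> k)) |i j k.
    i \<in> {1..n} \<and> j \<in> {1..n} \<and> k \<in> {1..n}}"
  then obtain j k l where
    b: "b = (\<lambda>\<rho>. bloch (\<rho> j) \<bullet> cross3 (bloch (\<rho> k)) (bloch (\<rho> l)))"
    "j \<in> {1..n}" "k \<in> {1..n}" "l \<in> {1..n}"
    by blast
  show "(\<lambda>\<rho>. b \<rho> * t' \<rho>) \<in> scalars n"
    using assms(2)
  proof (rule overlap_span_linear_image)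
    fix b' assume "b' \<in> {\<lambda>\<rho>. bloch (\<rho> i) \<bullet> cross3 (bloch (\<rho> j)) (bloch (\<rho> k)) |i j k.
      i \<in> {1..n} \<and> j \<in> {1..n} \<and> k \<in> {1..n}}"
    then obtain j' k' l' where
      b': "b' = (\<lambda>\<rho>. bloch (\<rho> j') \<bullet> cross3 (bloch (\<rho> k')) (bloch (\<rho> l')))"
      "j' \<in> {1..n}" "k' \<in> {1..n}" "l' \<in> {1..n}"
      by blast
    show "(\<lambda>\<rho>. b \<rho> * b' \<rho>) \<in> scalars n"
      unfolding b(1) b'(1) triple_product_mult_eq_Gram scalars_eq using b b'
      by (intro overlap_functions_add overlap_functions_mult inner_bloch_overlap_functions
          overlap_functions_numeral)
  qed (simp add: linear_iff algebra_simps)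
qed (simp add: linear_iff algebra_simps)

section \<open>Bloch form of an arbitrary product\<close>

text \<open>The four functions are chosen before \<open>\<rho>\<close>, which makes the resulting
  polynomials uniform. The list varies while \<open>n\<close> stays fixed, so the classes do not
  change during the induction.\<close>

lemma foldr_density_matrices_eq_pauli:
  assumes "set is \<subseteq> {1..n}"
  shows "\<exists>s\<in>scalars n. \<exists>t\<in>pseudoscalars n. \<exists>u\<in>vectors n. \<exists>w\<in>pseudovectors n.
    \<forall>\<rho>. (\<forall>i\<in>{1..n}. \<rho> i \<in> density_matrices) \<longrightarrow>
      foldr (\<lambda>i M. \<rho> i ** M) is (mat 1) = pauli (s \<rho>) (t \<rho>) (u \<rho>) (w \<rho>)"
  using assms
proof (induction "is")
  case Nil
  show ?case
    by (rule bexI[of _ "\<lambda>_. 1"], rule bexI[of _ "\<lambda>_. 0"], rule bexI[of _ "\<lambda>_. 0"],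
        rule bexI[of _ "\<lambda>_. 0"]) (simp_all add: mat_1_eq_pauli zero overlap_span_base)
next
  case (Cons i "is")
  then obtain s t u w where
    mem: "s \<in> scalars n" "t \<in> pseudoscalars n" "u \<in> vectors n" "w \<in> pseudovectors n" and
    eq: "\<And>\<rho>. \<forall>i\<in>{1..n}. \<rho> i \<in> density_matrices \<Longrightarrow>
      foldr (\<lambda>i M. \<rho> i ** M) is (mat 1) = pauli (s \<rho>) (t \<rho>) (u \<rho>) (w \<rho>)"
    by auto
  have i: "i \<in> {1..n}"
    using Cons.prems by simp
  let ?r = "\<lambda>\<rho>. bloch (\<rho> i)"
  \<comment> \<open>The four witnesses are the components given by \<open>pauli_mult\<close>; every
    summand in them falls into the class required.\<close>
  let ?s = "\<lambda>\<rho>. (1/2) *\<^sub>R (s \<rho> + ?r \<rho> \<bullet> u \<rho>)"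
  let ?t = "\<lambda>\<rho>. (1/2) *\<^sub>R (t \<rho> + ?r \<rho> \<bullet> w \<rho>)"
  let ?u = "\<lambda>\<rho>. (1/2) *\<^sub>R (u \<rho> + s \<rho> *\<^sub>R ?r \<rho> - cross3 (?r \<rho>) (w \<rho>))"
  let ?w = "\<lambda>\<rho>. (1/2) *\<^sub>R (w \<rho> + t \<rho> *\<^sub>R ?r \<rho> + cross3 (?r \<rho>) (u \<rho>))"
  have half: "(\<lambda>_. 1/2) \<in> overlap_functions n"
    by (rule overlap_functions_numeral)
  have s': "?s \<in> scalars n"
    using mem i half by (intro overlap_span_scaleR overlap_span_add inner_bloch_vectors)
  have t': "?t \<in> pseudoscalars n"
    using mem i half by (intro overlap_span_scaleR overlap_span_add inner_bloch_pseudovectors)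
  have u': "?u \<in> vectors n"
    using overlap_span_scaleR[OF bloch_vectors[OF i], of s] mem i half
    by (intro overlap_span_scaleR[where f = "\<lambda>_. 1/2"] overlap_span_add overlap_span_diff
        cross3_bloch_pseudovectors) (simp_all add: scalars_eq)
  have w': "?w \<in> pseudovectors n"
    using mem i half
    by (intro overlap_span_scaleR[where f = "\<lambda>_. 1/2"] overlap_span_add
        scaleR_bloch_pseudoscalars cross3_bloch_vectors)
  have "foldr (\<lambda>i M. \<rho> i ** M) (i # is) (mat 1) = pauli (?s \<rho>) (?t \<rho>) (?u \<rho>) (?w \<rho>)"
    if "\<forall>i\<in>{1..n}. \<rho> i \<in> density_matrices" for \<rho> :: qubit_tuple
  proof -
    have "\<rho> i ** foldr (\<lambda>i M. \<rho> i ** M) is (mat 1)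
        = pauli (1/2) 0 ((1/2) *\<^sub>R ?r \<rho>) 0 ** pauli (s \<rho>) (t \<rho>) (u \<rho>) (w \<rho>)"
      using density_matrix_eq_pauli[OF that[rule_format, OF i]] eq[OF that]
      by (rule arg_cong2[where f = "(**)"])
    then show ?thesis
      by (simp only: pauli_mult foldr.simps o_apply)
  qed
  then show ?case
    by - (rule bexI[OF _ s'], rule bexI[OF _ t'], rule bexI[OF _ u'], rule bexI[OF _ w'],
      intro allI impI)
qed

section \<open>Real part and modulus of the Bargmann invariant\<close>

lemma bargmann_Re_cmod_polynomial:
  obtains P Q where "P \<in> overlap_polys n" "Q \<in> overlap_polys n"
    "\<And>\<rho> :: qubit_tuple. (\<And>i. i \<in> {1..n} \<Longrightarrow> \<rho> i \<in> density_matrices) \<Longrightarrow>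
      eval_poly P (overlap \<rho>) = of_real (Re (bargmann n \<rho>))"
    "\<And>\<rho> :: qubit_tuple. (\<And>i. i \<in> {1..n} \<Longrightarrow> \<rho> i \<in> density_matrices) \<Longrightarrow>
      eval_poly Q (overlap \<rho>) = of_real ((cmod (bargmann n \<rho>))\<^sup>2)"
proof -
  have "set [1..<Suc n] \<subseteq> {1..n}"
    by auto
  from foldr_density_matrices_eq_pauli[OF this] obtain s t u w where
    st: "s \<in> scalars n" "t \<in> pseudoscalars n" and
    prod: "\<And>\<rho>. \<forall>i\<in>{1..n}. \<rho> i \<in> density_matrices \<Longrightarrow>
      foldr (\<lambda>i M. \<rho> i ** M) [1..<Suc n] (mat 1) = pauli (s \<rho>) (t \<rho>) (u \<rho>) (w \<rho>)"
    by blast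
  have eq: "bargmann n \<rho> = Complex (2 * s \<rho>) (2 * t \<rho>)"
    if "\<And>i. i \<in> {1..n} \<Longrightarrow> \<rho> i \<in> density_matrices" for \<rho> :: qubit_tuple
  proof -
    have "\<forall>i\<in>{1..n}. \<rho> i \<in> density_matrices"
      using that by blast
    from prod[OF this] show ?thesis
      by (simp only: bargmann_def trace_pauli)
  qed
  \<comment> \<open>The pseudoscalar \<open>t\<close> enters the squared modulus only through its
    square, which is a scalar.\<close>
  have s: "s \<in> overlap_functions n" and tt: "(\<lambda>\<rho>. t \<rho> * t \<rho>) \<in> overlap_functions n"
    using st pseudoscalars_mult[OF st(2) st(2)] by (simp_all add: scalars_eq)
  have "(\<lambda>\<rho>. 2 * s \<rho>) \<in> overlap_functions n"
    using s by (intro overlap_functions_mult overlap_functions_numeral)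
  then obtain P where P: "P \<in> overlap_polys n"
    "\<And>\<rho>. (\<And>i. i \<in> {1..n} \<Longrightarrow> \<rho> i \<in> density_matrices) \<Longrightarrow>
      eval_poly P (overlap \<rho>) = of_real (2 * s \<rho>)"
    by (rule overlap_functionsE) blast
  have "(\<lambda>\<rho>. 4 * (s \<rho> * s \<rho> + t \<rho> * t \<rho>)) \<in> overlap_functions n"
    by (intro overlap_functions_mult[OF overlap_functions_numeral(3)]
        overlap_functions_add[OF overlap_functions_mult[OF s s] tt])
  then obtain Q where Q: "Q \<in> overlap_polys n"
    "\<And>\<rho>. (\<And>i. i \<in> {1..n} \<Longrightarrow> \<rho> i \<in> density_matrices) \<Longrightarrow>
      eval_poly Q (overlap \<rho>) = of_real (4 * (s \<rho> * s \<rho> + t \<rho> * t \<rho>))"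
    by (rule overlap_functionsE) blast
  show thesis
  proof (rule that[OF P(1) Q(1)])
    fix \<rho> :: qubit_tuple assume \<rho>: "\<And>i. i \<in> {1..n} \<Longrightarrow> \<rho> i \<in> density_matrices"
    show "eval_poly P (overlap \<rho>) = of_real (Re (bargmann n \<rho>))"
      using P(2)[OF \<rho>] eq[OF \<rho>] by simp
    show "eval_poly Q (overlap \<rho>) = of_real ((cmod (bargmann n \<rho>))\<^sup>2)"
      using Q(2)[OF \<rho>] eq[OF \<rho>] by (simp add: cmod_def power2_eq_square algebra_simps)
  qed
qed

lemma eq_or_eq_cnj_if_Re_cmod_eq:
  assumes "Re z = Re z'" "cmod z = cmod z'"
  shows "z = z' \<or> z = cnj z'"
proof -
  have "(Im z)\<^sup>2 = (Im z')\<^sup>2"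
    using assms cmod_power2[of z] cmod_power2[of z'] by simp
  then show ?thesis
    using assms by (auto simp: power2_eq_iff complex_eq_iff)
qed

theorem theoremV1:
  fixes n :: nat
  assumes "n \<ge> 1"
  shows "(\<forall>(\<rho> :: nat \<Rightarrow> complex ^ 2 ^ 2) (\<sigma> :: nat \<Rightarrow> complex ^ 2 ^ 2).
            (\<forall>i\<in>{1..n}. \<rho> i \<in> density_matrices) \<longrightarrow>
            (\<forall>i\<in>{1..n}. \<sigma> i \<in> density_matrices) \<longrightarrow>
            (\<forall>i\<in>{1..n}. \<forall>j\<in>{1..n}. overlap \<rho> (i, j) = overlap \<sigma> (i, j)) \<longrightarrow>
            bargmann n \<sigma> = bargmann n \<rho> \<or> bargmann n \<sigma> = cnj (bargmann n \<rho>))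
       \<and> (\<exists>P\<in>overlap_polys n. \<exists>Q\<in>overlap_polys n.
            \<forall>\<rho> :: nat \<Rightarrow> complex ^ 2 ^ 2. (\<forall>i\<in>{1..n}. \<rho> i \<in> density_matrices) \<longrightarrow>
              (bargmann n \<rho>)\<^sup>2 - 2 * eval_poly P (overlap \<rho>) * bargmann n \<rho>
                + eval_poly Q (overlap \<rho>) = 0)"
proof (rule bargmann_Re_cmod_polynomial[of n])
  fix P Q
  assume PQ: "P \<in> overlap_polys n" "Q \<in> overlap_polys n"
    and P: "\<And>\<rho> :: qubit_tuple. (\<And>i. i \<in> {1..n} \<Longrightarrow> \<rho> i \<in> density_matrices) \<Longrightarrow>
      eval_poly P (overlap \<rho>) = of_real (Re (bargmann n \<rho>))"
    and Q: "\<And>\<rho> :: qubit_tuple. (\<And>i. i \<in> {1..n} \<Longrightarrow> \<rho> i \<in> density_matrices) \<Longrightarrow>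
      eval_poly Q (overlap \<rho>) = of_real ((cmod (bargmann n \<rho>))\<^sup>2)"
  show ?thesis
  \<comment> \<open>The same pair serves both claims: \<open>P\<close> and \<open>Q\<close> witness
    the existential, and their values fix real part and modulus in the first conjunct.\<close>
  proof (rule conjI; (rule bexI[OF bexI[OF _ PQ(2)] PQ(1)])?; intro allI impI)
    fix \<rho> \<sigma> :: qubit_tuple
    assume \<rho>: "\<forall>i\<in>{1..n}. \<rho> i \<in> density_matrices" and \<sigma>: "\<forall>i\<in>{1..n}. \<sigma> i \<in> density_matrices"
      and eq: "\<forall>i\<in>{1..n}. \<forall>j\<in>{1..n}. overlap \<rho> (i, j) = overlap \<sigma> (i, j)"
    have "eval_poly P (overlap \<sigma>) = eval_poly P (overlap \<rho>)"
      using eq by (intro eval_poly_cong[OF PQ(1)]) simp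
    then have "Re (bargmann n \<sigma>) = Re (bargmann n \<rho>)"
      using P[of \<rho>] P[of \<sigma>] \<rho> \<sigma> by simp
    moreover have "eval_poly Q (overlap \<sigma>) = eval_poly Q (overlap \<rho>)"
      using eq by (intro eval_poly_cong[OF PQ(2)]) simp
    then have "complex_of_real ((cmod (bargmann n \<sigma>))\<^sup>2) = of_real ((cmod (bargmann n \<rho>))\<^sup>2)"
      using Q[of \<rho>] Q[of \<sigma>] \<rho> \<sigma> by simp
    then have "cmod (bargmann n \<sigma>) = cmod (bargmann n \<rho>)"
      by (simp only: of_real_eq_iff) simp
    ultimately show "bargmann n \<sigma> = bargmann n \<rho> \<or> bargmann n \<sigma> = cnj (bargmann n \<rho>)"
      by (rule eq_or_eq_cnj_if_Re_cmod_eq)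
  next
    fix \<rho> :: qubit_tuple assume \<rho>: "\<forall>i\<in>{1..n}. \<rho> i \<in> density_matrices"
    \<comment> \<open>By Vieta, the quadratic is the one whose roots are the invariant and its
      conjugate.\<close>
    have "2 * eval_poly P (overlap \<rho>) = bargmann n \<rho> + cnj (bargmann n \<rho>)"
      using P[of \<rho>] \<rho> by (simp add: complex_add_cnj)
    moreover have "eval_poly Q (overlap \<rho>) = bargmann n \<rho> * cnj (bargmann n \<rho>)"
      using Q[of \<rho>] \<rho> by (simp add: complex_norm_square[symmetric] del: of_real_power)
    ultimately show "(bargmann n \<rho>)\<^sup>2 - 2 * eval_poly P (overlap \<rho>) * bargmann n \<rho>
        + eval_poly Q (overlap \<rho>) = 0"
      by (simp add: power2_eq_square algebra_simps)
  qed
qed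

end
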